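(* Let $\mu(\sigma)\propto\exp\left(\sum_{\phi\in\Phi}\phi(\sigma)\right)$ be the Gibbs measure on $\Omega=[s]^V$ of a factor graph $(V,\Phi,E)$. Let $\mathcal A\subseteq2^V$ be a family of blocks and $p=\{p_A\}_{A\in\mathcal A}$ nonnegative scan probabilities with $\sum_{A\in\mathcal A}p_A=1$ and $\gamma(p):=\min_{x\in V}\sum_{A\in\mathcal A:\,x\in A}p_A>0$. Suppose there is a constant $C_p<\infty$ such that for every $f:\Omega\to[0,\infty)$, $$\gamma(p)\,\mathrm{Ent}_V(f)\le C_p\sum_{A\in\mathcal A}p_A\,\mu\bigl(\mathrm{Ent}_Af\bigr).$$ For each $A\in\mathcal A$ and each $\tau_{A^c}\in[s]^{A^c}$, let $q_A^{\tau_{A^c}}$ be a probability distribution on $[s]^A$, and define the transition kernels on $\Omega$ $$\widetilde K_A(\tau,\sigma)=\mathbf 1\{\sigma_{A^c}=\tau_{A^c}\}\,q_A^{\tau_{A^c}}(\sigma_A),\qquad \widetilde K=\sum_{A\in\mathcal A}p_A\widetilde K_A .$$ Let $\widetilde\mu$ be any invariant distribution of $\widetilde K$. Then $$d_{\mathrm H}^2(\widetilde\mu,\mu)\le d_{\mathrm{KL}}(\widetilde\mu,\mu)\le\frac{C_p}{\gamma(p)}\sum_{A\in\mathcal A}p_A\,\mathbb E_{\widetilde\mu_{A^c}}\left[d_{\mathrm{KL}}\left(q_A^{\tau_{A^c}},\mu_A^{\tau_{A^c}}\right)\right].$$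
   Context: Fix $s\in\mathbb N$ and $[s]=\{1,\dots,s\}$. A factor graph $(V,\Phi,E)$ consists of a finite set $V$ (vertices), a set $E$ of unordered pairs of distinct vertices, and a finite indexed collection $\Phi$ of functions $\phi:[s]^V\to\mathbb R$, each equipped with a nonempty scope $S[\phi]\subseteq V$ and depending only on the coordinates in $S[\phi]$. For probability measures on a finite set: $d_{\mathrm H}(\nu,\mu)=\left(\sum_\sigma(\sqrt{\nu(\sigma)}-\sqrt{\mu(\sigma)})^2\right)^{1/2}$ and $d_{\mathrm{KL}}(\nu,\mu)=\sum_\sigma\nu(\sigma)\log(\nu(\sigma)/\mu(\sigma))$. For $A\subseteq V$, $\sigma_A$ is the restriction of $\sigma$ to $A$, $\widetilde\mu_{A^c}$ is the marginal of $\widetilde\mu$ on $[s]^{A^c}$, and $\mathbb E_{\widetilde\mu_{A^c}}$ is expectation over $\tau_{A^c}\sim\widetilde\mu_{A^c}$. $\mu_A^{\tau_{A^c}}$ is the conditional law of $\sigma_A$ under $\mu$ given $\sigma_{A^c}=\tau_{A^c}$. For $f:\Omega\to[0,\infty)$, $\mu_A^{\tau_{A^c}}(f)$ is the expectation of $f(\sigma_A\tau_{A^c})$ with $\sigma_A\sim\mu_A^{\tau_{A^c}}$, $(\mathrm{Ent}_Af)(\tau_{A^c})=\mu_A^{\tau_{A^c}}\left[f\log\left(f/\mu_A^{\tau_{A^c}}(f)\right)\right]$ (with $0\log0=0$), $\mu(\mathrm{Ent}_Af)$ is its expectation under $\mu$, and $\mathrm{Ent}_V(f)=\mu\left[f\log(f/\mu(f))\right]$.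 *)

theory Defs
  imports "HOL-Probability.Probability"
begin

text \<open>The configuration space \<open>[s]\<^sup>A\<close>: extensional functions from \<open>A\<close> to \<open>{1..s}\<close>.  Thus the
  restriction \<open>\<sigma>\<^sub>A\<close> is \<^term>\<open>restrict \<sigma> A\<close>, and the configuration on \<open>V\<close> glued from \<open>\<eta>\<close> on \<open>A\<close>
  and \<open>\<tau>\<close> on \<open>V - A\<close> is \<^term>\<open>merge A (V - A) (\<eta>, \<tau>)\<close>.  Complements of blocks are always taken
  in \<open>V\<close>.\<close>

definition configs :: "nat \<Rightarrow> 'v set \<Rightarrow> ('v \<Rightarrow> nat) set" where
  "configs s A = PiE A (\<lambda>_. {1..s})"

locale factor_graph =
  fixes s :: nat
    and V :: "'v set"
    and I :: "'i set"
    and \<phi> :: "'i \<Rightarrow> ('v \<Rightarrow> nat) \<Rightarrow> real"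
    and S :: "'i \<Rightarrow> 'v set"
    and E :: "'v set set"
  assumes finite_V: "finite V"
    and E_pairs: "E \<subseteq> {{u, v} | u v. u \<in> V \<and> v \<in> V \<and> u \<noteq> v}"
    and finite_I: "finite I"
    and scope_nonempty: "i \<in> I \<Longrightarrow> S i \<noteq> {}"
    and scope_subset: "i \<in> I \<Longrightarrow> S i \<subseteq> V"
    and scope_dep: "\<lbrakk>i \<in> I; \<sigma> \<in> configs s V; \<tau> \<in> configs s V; \<And>x. x \<in> S i \<Longrightarrow> \<sigma> x = \<tau> x\<rbrakk>
                      \<Longrightarrow> \<phi> i \<sigma> = \<phi> i \<tau>"

definition gibbs_weight :: "'i set \<Rightarrow> ('i \<Rightarrow> ('v \<Rightarrow> nat) \<Rightarrow> real) \<Rightarrow> ('v \<Rightarrow> nat) \<Rightarrow> real" where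
  "gibbs_weight I \<phi> \<sigma> = exp (\<Sum>i\<in>I. \<phi> i \<sigma>)"

definition gibbs :: "nat \<Rightarrow> 'v set \<Rightarrow> 'i set \<Rightarrow> ('i \<Rightarrow> ('v \<Rightarrow> nat) \<Rightarrow> real) \<Rightarrow> ('v \<Rightarrow> nat) pmf" where
  "gibbs s V I \<phi> = embed_pmf (\<lambda>\<sigma>. if \<sigma> \<in> configs s V
     then gibbs_weight I \<phi> \<sigma> / (\<Sum>\<tau>\<in>configs s V. gibbs_weight I \<phi> \<tau>) else 0)"

definition marginal :: "('v \<Rightarrow> nat) pmf \<Rightarrow> 'v set \<Rightarrow> ('v \<Rightarrow> nat) pmf" where
  "marginal \<mu> B = map_pmf (\<lambda>\<sigma>. restrict \<sigma> B) \<mu>"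

text \<open>The conditional law \<open>\<mu>\<^sub>A\<close> of \<open>\<sigma>\<^sub>A\<close> given that \<open>\<sigma>\<close> equals \<open>\<tau>\<close> on \<open>V - A\<close>.  It is meaningful when the
  conditioning event has positive probability, which for a Gibbs measure holds for all
  \<open>\<tau> \<in> configs s (V - A)\<close>.\<close>

definition cond_law ::
    "'v set \<Rightarrow> ('v \<Rightarrow> nat) pmf \<Rightarrow> 'v set \<Rightarrow> ('v \<Rightarrow> nat) \<Rightarrow> ('v \<Rightarrow> nat) pmf" where
  "cond_law V \<mu> A \<tau> = map_pmf (\<lambda>\<sigma>. restrict \<sigma> A) (cond_pmf \<mu> {\<sigma>. restrict \<sigma> (V - A) = \<tau>})"

definition hellinger_dist :: "'a set \<Rightarrow> 'a pmf \<Rightarrow> 'a pmf \<Rightarrow> real" where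
  "hellinger_dist X \<nu> \<mu> = sqrt (\<Sum>\<sigma>\<in>X. (sqrt (pmf \<nu> \<sigma>) - sqrt (pmf \<mu> \<sigma>))\<^sup>2)"

text \<open>The real-valued Kullback--Leibler divergence on a finite set \<open>X\<close>.  Terms with \<open>\<nu>(\<sigma>) = 0\<close>
  vanish.  The formula is adequate only when \<open>\<nu>\<close> is absolutely continuous with respect to \<open>\<mu>\<close>;
  below, the second argument is always a Gibbs measure or one of its conditional laws, which
  have full support.\<close>

definition kl_div :: "'a set \<Rightarrow> 'a pmf \<Rightarrow> 'a pmf \<Rightarrow> real" where
  "kl_div X \<nu> \<mu> = (\<Sum>\<sigma>\<in>X. pmf \<nu> \<sigma> * ln (pmf \<nu> \<sigma> / pmf \<mu> \<sigma>))"

text \<open>\<open>ent \<mu> f = \<mu>[f log (f / \<mu>(f))]\<close>.  If \<open>\<mu>(f) = 0\<close> for a nonnegative \<open>f\<close>, then \<open>f = 0\<close> almost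
  surely and the value is \<open>0\<close>, as intended.\<close>

definition ent :: "'a pmf \<Rightarrow> ('a \<Rightarrow> real) \<Rightarrow> real" where
  "ent \<mu> f = measure_pmf.expectation \<mu> (\<lambda>\<sigma>. f \<sigma> * ln (f \<sigma> / measure_pmf.expectation \<mu> f))"

definition block_ent ::
    "'v set \<Rightarrow> ('v \<Rightarrow> nat) pmf \<Rightarrow> 'v set \<Rightarrow> (('v \<Rightarrow> nat) \<Rightarrow> real) \<Rightarrow> ('v \<Rightarrow> nat) \<Rightarrow> real" where
  "block_ent V \<mu> A f \<tau> = ent (cond_law V \<mu> A \<tau>) (\<lambda>\<eta>. f (merge A (V - A) (\<eta>, \<tau>)))"

definition mean_block_ent ::
    "'v set \<Rightarrow> ('v \<Rightarrow> nat) pmf \<Rightarrow> 'v set \<Rightarrow> (('v \<Rightarrow> nat) \<Rightarrow> real) \<Rightarrow> real" where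
  "mean_block_ent V \<mu> A f =
     measure_pmf.expectation \<mu> (\<lambda>\<sigma>. block_ent V \<mu> A f (restrict \<sigma> (V - A)))"

definition min_cover :: "'v set \<Rightarrow> 'v set set \<Rightarrow> ('v set \<Rightarrow> real) \<Rightarrow> real" where
  "min_cover V \<A> p = Min ((\<lambda>x. \<Sum>A\<in>{A \<in> \<A>. x \<in> A}. p A) ` V)"

definition block_kernel ::
    "'v set \<Rightarrow> ('v set \<Rightarrow> ('v \<Rightarrow> nat) \<Rightarrow> ('v \<Rightarrow> nat) pmf) \<Rightarrow> 'v set
      \<Rightarrow> ('v \<Rightarrow> nat) \<Rightarrow> ('v \<Rightarrow> nat) \<Rightarrow> real" where
  "block_kernel V q A \<tau> \<sigma> =
     (if restrict \<sigma> (V - A) = restrict \<tau> (V - A)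
      then pmf (q A (restrict \<tau> (V - A))) (restrict \<sigma> A) else 0)"

definition scan_kernel ::
    "'v set \<Rightarrow> 'v set set \<Rightarrow> ('v set \<Rightarrow> real) \<Rightarrow> ('v set \<Rightarrow> ('v \<Rightarrow> nat) \<Rightarrow> ('v \<Rightarrow> nat) pmf)
      \<Rightarrow> ('v \<Rightarrow> nat) \<Rightarrow> ('v \<Rightarrow> nat) \<Rightarrow> real" where
  "scan_kernel V \<A> p q \<tau> \<sigma> = (\<Sum>A\<in>\<A>. p A * block_kernel V q A \<tau> \<sigma>)"

definition invariant_dist ::
    "'a set \<Rightarrow> ('a \<Rightarrow> 'a \<Rightarrow> real) \<Rightarrow> 'a pmf \<Rightarrow> bool" where
  "invariant_dist X K \<nu> \<longleftrightarrow>
     set_pmf \<nu> \<subseteq> X \<and> (\<forall>\<sigma>\<in>X. (\<Sum>\<tau>\<in>X. pmf \<nu> \<tau> * K \<tau> \<sigma>) = pmf \<nu> \<sigma>)"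

lemma finite_configs: "finite A \<Longrightarrow> finite (configs s A)"
  unfolding configs_def by (rule finite_PiE) auto

lemma (in factor_graph) pmf_gibbs:
  assumes "configs s V \<noteq> {}"
  shows "pmf (gibbs s V I \<phi>) \<sigma> = (if \<sigma> \<in> configs s V
     then gibbs_weight I \<phi> \<sigma> / (\<Sum>\<tau>\<in>configs s V. gibbs_weight I \<phi> \<tau>) else 0)"
proof -
  let ?X = "configs s V" and ?w = "gibbs_weight I \<phi>"
  let ?f = "\<lambda>\<sigma>. if \<sigma> \<in> ?X then ?w \<sigma> / (\<Sum>\<tau>\<in>?X. ?w \<tau>) else 0"
  have fin: "finite ?X" by (rule finite_configs[OF finite_V])
  have pos: "?w \<tau> > 0" for \<tau> by (simp add: gibbs_weight_def)
  have Z: "(\<Sum>\<tau>\<in>?X. ?w \<tau>) > 0" using fin assms pos by (intro sum_pos) auto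
  have nn: "?f \<tau> \<ge> 0" for \<tau> using Z pos[of \<tau>] by auto
  have "(\<integral>\<^sup>+ x. ennreal (?f x) \<partial>count_space UNIV) = (\<Sum>x\<in>?X. ennreal (?f x))"
    by (rule nn_integral_count_space'[OF fin]) auto
  also have "\<dots> = ennreal (\<Sum>x\<in>?X. ?f x)" by (rule sum_ennreal) (rule nn)
  also have "(\<Sum>x\<in>?X. ?f x) = 1" using Z by (simp add: sum_divide_distrib[symmetric])
  finally show ?thesis unfolding gibbs_def using nn by (subst pmf_embed_pmf) auto
qed

lemma kl_div_eq_KL_divergence:
  assumes X: "finite X" and \<mu>: "set_pmf \<mu> = X" and \<nu>: "set_pmf \<nu> \<subseteq> X"
  shows "kl_div X \<nu> \<mu> = KL_divergence (exp 1) (measure_pmf \<mu>) (measure_pmf \<nu>)"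
proof -
  let ?r = "\<lambda>x. pmf \<nu> x / pmf \<mu> x"
  have eq: "pmf \<mu> x * ?r x = pmf \<nu> x" for x
    using \<mu> \<nu> by (auto simp: pmf_eq_0_set_pmf)
  have 1: "measure_pmf \<nu> = density (measure_pmf \<mu>) (\<lambda>x. ennreal (?r x))"
  proof -
    have "density (measure_pmf \<mu>) (\<lambda>x. ennreal (?r x))
        = density (count_space UNIV) (\<lambda>x. ennreal (pmf \<mu> x) * ennreal (?r x))"
      by (subst measure_pmf_eq_density, subst density_density_eq) auto
    also have "\<dots> = density (count_space UNIV) (\<lambda>x. ennreal (pmf \<nu> x))"
      by (simp only: ennreal_mult[symmetric] pmf_nonneg eq divide_nonneg_nonneg)
    finally show ?thesis by (simp add: measure_pmf_eq_density)
  qed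
  have "KL_divergence (exp 1) (measure_pmf \<mu>) (measure_pmf \<nu>)
      = (\<integral>x. ?r x * log (exp 1) (?r x) \<partial>measure_pmf \<mu>)"
    unfolding 1 by (rule sigma_finite_measure.KL_density[OF measure_pmf.sigma_finite_measure_axioms]) auto
  also have "\<dots> = (\<Sum>x\<in>X. pmf \<mu> x * (?r x * log (exp 1) (?r x)))"
    using X \<mu> by (subst integral_measure_pmf[of X]) auto
  also have "\<dots> = kl_div X \<nu> \<mu>"
    unfolding kl_div_def mult.assoc[symmetric] eq by (simp add: log_def)
  finally show ?thesis by simp
qed

end

theory Submission
  imports Defs
begin

text \<open>For a block \<open>A\<close> with complement \<open>B\<close>, apply the chain rule for relative entropy twice.
  With \<open>f = \<mu>' / \<mu>\<close> it gives \<open>KL(\<mu>' | \<mu>) = KL(\<mu>'\<^sub>B | \<mu>\<^sub>B) + \<mu>(Ent\<^sub>A f)\<close>. The updated law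
  \<open>\<mu>' K\<^sub>A\<close> has the same marginal on \<open>B\<close> as \<open>\<mu>'\<close>, so its divergence from \<open>\<mu>\<close> is
  \<open>KL(\<mu>'\<^sub>B | \<mu>\<^sub>B)\<close> plus the mean of \<open>KL(q\<^sub>A | \<mu>\<^sub>A)\<close>. By invariance \<open>\<mu>'\<close> is the mixture of the
  \<open>\<mu>' K\<^sub>A\<close> with weights \<open>p\<^sub>A\<close>, and convexity of KL cancels the marginal terms; what remains bounds
  the right-hand side of the factorization inequality at \<open>f\<close>.\<close>

section \<open>Pointwise inequalities for \<open>x * ln (x / y)\<close> and their summed
  forms\<close>

text \<open>The bound \<open>ln t \<le> t - 1\<close> at \<open>t = y / x\<close>, multiplied by
  \<open>x\<close>. The last hypothesis is pointwise absolute continuity: at \<open>y = 0\<close>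
  the quotient only has its default value.\<close>

lemma xlnx_ge:
  fixes x y :: real
  assumes "0 \<le> x" "0 \<le> y" "y = 0 \<Longrightarrow> x = 0"
  shows "x - y \<le> x * ln (x / y)"
proof (cases "x = 0")
  case False
  then have xy: "x > 0" "y > 0" using assms by (auto simp: order.order_iff_strict)
  have "ln (y / x) \<le> y / x - 1" using xy by (intro ln_le_minus_one) simp
  then have "x * ln (y / x) \<le> x * (y / x - 1)" using xy by (intro mult_left_mono) auto
  then show ?thesis using xy by (simp add: ln_div algebra_simps)
qed (use assms in auto)

text \<open>This is \<open>xlnx_ge\<close> for the square roots, scaled by
  \<open>2 * sqrt x\<close>; the logarithm of a square root absorbs the factor 2. The correction
  \<open>x - y\<close> sums to zero over two probability measures, which leaves the Hellinger
  bound.\<close>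

lemma hellinger_le_xlnx:
  fixes x y :: real
  assumes "0 \<le> x" "0 < y"
  shows "(sqrt x - sqrt y)\<^sup>2 + x - y \<le> x * ln (x / y)"
proof -
  have "2 * sqrt x * (sqrt x - sqrt y) \<le> 2 * sqrt x * (sqrt x * ln (sqrt x / sqrt y))"
    using assms by (intro mult_left_mono xlnx_ge) auto
  also have "\<dots> = x * (2 * ln (sqrt (x / y)))"
    using assms by (simp add: real_sqrt_divide)
  also have "\<dots> = x * ln (x / y)"
    using assms by (cases "x = 0") (auto simp: ln_sqrt)
  finally have "2 * sqrt x * (sqrt x - sqrt y) \<le> x * ln (x / y)" .
  moreover have "sqrt x * sqrt x = x" "sqrt y * sqrt y = y" using assms by simp_all
  then have "(sqrt x - sqrt y)\<^sup>2 + x - y = 2 * sqrt x * (sqrt x - sqrt y)"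
    by (simp add: power2_eq_square right_diff_distrib left_diff_distrib)
  ultimately show ?thesis by simp
qed

lemma hellinger_dist_le_kl_div:
  assumes "finite X" "set_pmf \<nu> \<subseteq> X" "set_pmf \<mu> = X"
  shows "(hellinger_dist X \<nu> \<mu>)\<^sup>2 \<le> kl_div X \<nu> \<mu>"
proof -
  have "(hellinger_dist X \<nu> \<mu>)\<^sup>2 = (\<Sum>\<sigma>\<in>X. (sqrt (pmf \<nu> \<sigma>) - sqrt (pmf \<mu> \<sigma>))\<^sup>2 + pmf \<nu> \<sigma> - pmf \<mu> \<sigma>)"
    using assms by (simp add: hellinger_dist_def sum_nonneg sum.distrib sum_subtractf sum_pmf_eq_1)
  also have "\<dots> \<le> kl_div X \<nu> \<mu>"
    unfolding kl_div_def using assms by (intro sum_mono hellinger_le_xlnx) (auto simp: pmf_positive)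
  finally show ?thesis .
qed

text \<open>Jensen's inequality for the convex function \<open>z * ln (z / y)\<close>: its graph
  lies above the tangent line at the mean \<open>x\<close>, and averaging that line with the weights
  returns the value at \<open>x\<close>.\<close>

lemma mixture_xlnx_le:
  fixes r :: "'a \<Rightarrow> real"
  assumes fin: "finite T" and p: "\<And>t. t \<in> T \<Longrightarrow> 0 \<le> p t" "(\<Sum>t\<in>T. p t) = 1"
    and r: "\<And>t. t \<in> T \<Longrightarrow> 0 \<le> r t" and y: "0 < y"
  defines "x \<equiv> \<Sum>t\<in>T. p t * r t"
  shows "x * ln (x / y) \<le> (\<Sum>t\<in>T. p t * (r t * ln (r t / y)))"
proof -
  have x0: "0 \<le> x" unfolding x_def using p r by (intro sum_nonneg) auto
  show ?thesis
  proof (cases "x = 0")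
    case True
    then have "p t * r t = 0" if "t \<in> T" for t
      using that fin p r unfolding x_def by (subst (asm) sum_nonneg_eq_0_iff) auto
    then have "(\<Sum>t\<in>T. p t * (r t * ln (r t / y))) = 0" by (intro sum.neutral) auto
    then show ?thesis using True by simp
  next
    case False
    then have x: "x > 0" using x0 by simp
    \<comment> \<open>The left-hand side is the tangent line at \<open>x\<close>, evaluated at
      \<open>r t\<close>; the gap is \<open>r t * ln (r t / x) - (r t - x)\<close>, nonnegative by
      \<open>xlnx_ge\<close>.\<close>
    have le: "r t - x + r t * ln (x / y) \<le> r t * ln (r t / y)" if t: "t \<in> T" for t
    proof (cases "r t = 0")
      case False
      then have "r t > 0" using r[OF t] by simp
      moreover have "r t - x \<le> r t * ln (r t / x)" using r[OF t] x by (intro xlnx_ge) auto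
      ultimately show ?thesis using x y by (simp add: ln_div algebra_simps)
    qed (use x in auto)
    have "x * ln (x / y) = (\<Sum>t\<in>T. p t * (r t - x + r t * ln (x / y)))"
    proof -
      have "(\<Sum>t\<in>T. p t * (r t - x + r t * ln (x / y)))
          = (\<Sum>t\<in>T. p t * r t - p t * x + p t * r t * ln (x / y))"
        by (simp add: algebra_simps)
      also have "\<dots> = x - x + x * ln (x / y)"
        using p(2) by (simp add: sum.distrib sum_subtractf x_def flip: sum_distrib_right)
      finally show ?thesis by simp
    qed
    also have "\<dots> \<le> (\<Sum>t\<in>T. p t * (r t * ln (r t / y)))"
      using p le by (intro sum_mono mult_left_mono) auto
    finally show ?thesis .
  qed
qed

text \<open>Integrate \<open>xlnx_ge\<close> with the mean \<open>?c\<close> in the place of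
  \<open>y\<close>: the deviations \<open>f \<sigma> - ?c\<close> average to zero.\<close>

lemma ent_nonneg:
  assumes fin: "finite (set_pmf \<mu>)" and f: "\<And>\<sigma>. \<sigma> \<in> set_pmf \<mu> \<Longrightarrow> 0 \<le> f \<sigma>"
  shows "0 \<le> ent \<mu> f"
proof -
  let ?c = "measure_pmf.expectation \<mu> f"
  have int: "integrable (measure_pmf \<mu>) g" for g :: "_ \<Rightarrow> real"
    using fin by (rule integrable_measure_pmf_finite)
  have c: "0 \<le> ?c" using f by (intro integral_nonneg_AE) (simp add: AE_measure_pmf_iff)
  \<comment> \<open>A nonnegative function of mean zero vanishes on the support, which gives the
    absolute continuity that \<open>xlnx_ge\<close> asks for.\<close>
  have zero: "f \<sigma> = 0" if "?c = 0" "\<sigma> \<in> set_pmf \<mu>" for \<sigma>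
    using that f integral_nonneg_eq_0_iff_AE[OF int, of f] by (simp add: AE_measure_pmf_iff)
  have "0 = measure_pmf.expectation \<mu> (\<lambda>\<sigma>. f \<sigma> - ?c)"
    using int by simp
  also have "\<dots> \<le> ent \<mu> f"
    unfolding ent_def using f c zero
    by (intro integral_mono_AE int) (auto simp: AE_measure_pmf_iff intro!: xlnx_ge)
  finally show ?thesis .
qed

section \<open>Splitting a configuration into a block and its complement\<close>

locale config_block =
  fixes s :: nat and V A B :: "'v set"
  assumes fin: "finite V" and sub: "A \<subseteq> V"
  defines "B \<equiv> V - A"
begin

abbreviation glue where "glue \<eta> \<tau> \<equiv> merge A B (\<eta>, \<tau>)"

text \<open>As a simp rule it could strip the restrictions in
  \<open>glue (restrict \<sigma> A) (restrict \<sigma> B)\<close> before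
  \<open>glue_restrict\<close> matches.\<close>

declare merge_restrict [simp del]

lemma finite_blocks [simp]: "finite (configs s A)" "finite (configs s B)" "finite (configs s V)"
  using fin sub by (auto intro!: finite_configs simp: B_def finite_subset)

lemma restrict_glue [simp]:
  assumes "\<eta> \<in> configs s A" "\<tau> \<in> configs s B"
  shows "restrict (glue \<eta> \<tau>) A = \<eta>" "restrict (glue \<eta> \<tau>) B = \<tau>"
  using assms unfolding configs_def B_def
  by (auto simp: restrict_def merge_def fun_eq_iff PiE_def extensional_def)

lemma glue_restrict [simp]:
  assumes "\<sigma> \<in> configs s V"
  shows "glue (restrict \<sigma> A) (restrict \<sigma> B) = \<sigma>"
  using assms sub unfolding configs_def B_def
  by (auto simp: restrict_def merge_def fun_eq_iff PiE_def extensional_def)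

lemma glue_in [simp]:
  assumes "\<eta> \<in> configs s A" "\<tau> \<in> configs s B"
  shows "glue \<eta> \<tau> \<in> configs s V"
  using assms sub unfolding configs_def B_def
  by (auto simp: merge_def PiE_def extensional_def Pi_def)

lemma restrict_in [simp]:
  assumes "\<sigma> \<in> configs s V"
  shows "restrict \<sigma> A \<in> configs s A" "restrict \<sigma> B \<in> configs s B"
  using assms sub unfolding configs_def B_def by (auto simp: PiE_def Pi_def)

text \<open>Gluing and the pair of restrictions are mutually inverse. The complement is the outer
  index, so that each inner sum runs over one conditioning event.\<close>

lemma sum_configs:
  fixes h :: "('v \<Rightarrow> nat) \<Rightarrow> real"
  shows "(\<Sum>\<sigma>\<in>configs s V. h \<sigma>) = (\<Sum>\<tau>\<in>configs s B. \<Sum>\<eta>\<in>configs s A. h (glue \<eta> \<tau>))"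
proof -
  have "(\<Sum>\<sigma>\<in>configs s V. h \<sigma>)
      = (\<Sum>(\<tau>, \<eta>)\<in>configs s B \<times> configs s A. h (glue \<eta> \<tau>))"
    by (rule sum.reindex_bij_witness[where i = "\<lambda>(\<tau>, \<eta>). glue \<eta> \<tau>"
          and j = "\<lambda>\<sigma>. (restrict \<sigma> B, restrict \<sigma> A)"]) auto
  then show ?thesis by (simp only: sum.cartesian_product)
qed

lemma fiber_eq:
  assumes "\<tau> \<in> configs s B"
  shows "{\<sigma> \<in> configs s V. restrict \<sigma> B = \<tau>} = (\<lambda>\<eta>. glue \<eta> \<tau>) ` configs s A"
proof (intro equalityI subsetI)
  fix \<sigma> assume "\<sigma> \<in> {\<sigma> \<in> configs s V. restrict \<sigma> B = \<tau>}"
  then show "\<sigma> \<in> (\<lambda>\<eta>. glue \<eta> \<tau>) ` configs s A"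
    by (intro image_eqI[where x = "restrict \<sigma> A"]) auto
qed (use assms in auto)

lemma inj_glue: "\<tau> \<in> configs s B \<Longrightarrow> inj_on (\<lambda>\<eta>. glue \<eta> \<tau>) (configs s A)"
  by (rule inj_on_inverseI[where g = "\<lambda>\<sigma>. restrict \<sigma> A"]) simp

lemma prob_fiber:
  assumes \<nu>: "set_pmf \<nu> \<subseteq> configs s V" and \<tau>: "\<tau> \<in> configs s B"
  shows "measure_pmf.prob \<nu> {\<sigma>. restrict \<sigma> B = \<tau>} = (\<Sum>\<eta>\<in>configs s A. pmf \<nu> (glue \<eta> \<tau>))"
proof -
  \<comment> \<open>The measure \<open>\<nu>\<close> has no mass outside \<open>configs s V\<close>,
    so the event may be cut down to a finite fiber.\<close>
  have "measure_pmf.prob \<nu> {\<sigma>. restrict \<sigma> B = \<tau>}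
      = measure_pmf.prob \<nu> {\<sigma> \<in> configs s V. restrict \<sigma> B = \<tau>}"
    using \<nu> by (intro measure_prob_cong_0) (auto simp: pmf_eq_0_set_pmf)
  also have "\<dots> = (\<Sum>\<sigma>\<in>(\<lambda>\<eta>. glue \<eta> \<tau>) ` configs s A. pmf \<nu> \<sigma>)"
    unfolding fiber_eq[OF \<tau>] by (intro measure_measure_pmf_finite) simp
  also have "\<dots> = (\<Sum>\<eta>\<in>configs s A. pmf \<nu> (glue \<eta> \<tau>))"
    using inj_glue[OF \<tau>] by (simp add: sum.reindex)
  finally show ?thesis .
qed

lemma pmf_marginal:
  assumes "set_pmf \<nu> \<subseteq> configs s V" "\<tau> \<in> configs s B"
  shows "pmf (marginal \<nu> B) \<tau> = (\<Sum>\<eta>\<in>configs s A. pmf \<nu> (glue \<eta> \<tau>))"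
  unfolding marginal_def pmf_map prob_fiber[OF assms, symmetric] by (simp add: vimage_def)

lemma set_marginal:
  "set_pmf \<nu> \<subseteq> configs s V \<Longrightarrow> set_pmf (marginal \<nu> B) \<subseteq> configs s B"
  unfolding marginal_def by auto

lemma expectation_restrict:
  assumes "set_pmf \<nu> \<subseteq> configs s V"
  shows "measure_pmf.expectation \<nu> (\<lambda>\<sigma>. g (restrict \<sigma> B))
    = (\<Sum>\<tau>\<in>configs s B. pmf (marginal \<nu> B) \<tau> * (g \<tau> :: real))"
proof -
  have "measure_pmf.expectation \<nu> (\<lambda>\<sigma>. g (restrict \<sigma> B)) = measure_pmf.expectation (marginal \<nu> B) g"
    by (simp add: marginal_def)
  also have "\<dots> = (\<Sum>\<tau>\<in>configs s B. g \<tau> * pmf (marginal \<nu> B) \<tau>)"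
    using set_marginal[OF assms] by (intro integral_measure_pmf_real) auto
  finally show ?thesis by (simp add: mult.commute)
qed

section \<open>Chain rules for relative entropy against a measure of full support\<close>

context
  fixes \<mu> :: "('v \<Rightarrow> nat) pmf"
  assumes full: "set_pmf \<mu> = configs s V"
begin

lemma marginal_pos:
  assumes "\<tau> \<in> configs s B"
  shows "0 < pmf (marginal \<mu> B) \<tau>"
proof -
  \<comment> \<open>Any configuration on \<open>V\<close> serves to fill the block \<open>A\<close>,
    so that \<open>\<tau>\<close> extends to a point of the support.\<close>
  obtain \<sigma> where \<sigma>: "\<sigma> \<in> configs s V" using set_pmf_not_empty[of \<mu>] full by auto
  have "glue (restrict \<sigma> A) \<tau> \<in> set_pmf \<mu>"
    using full \<sigma> assms by simp
  then have "restrict (glue (restrict \<sigma> A) \<tau>) B \<in> set_pmf (marginal \<mu> B)"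
    unfolding marginal_def by simp
  then show ?thesis
    using restrict_glue(2)[OF restrict_in(1)[OF \<sigma>] assms] by (simp add: pmf_positive)
qed

text \<open>On the fiber over \<open>\<tau>\<close> a configuration is determined by its restriction
  to \<open>A\<close>, so the pushforward keeps point masses and only the normalisation by the
  fiber's mass remains.\<close>

lemma cond_law:
  assumes \<tau>: "\<tau> \<in> configs s B"
  shows set_cond_law: "set_pmf (cond_law V \<mu> A \<tau>) = configs s A"
    and pmf_cond_law: "\<eta> \<in> configs s A \<Longrightarrow>
      pmf (cond_law V \<mu> A \<tau>) \<eta> = pmf \<mu> (glue \<eta> \<tau>) / pmf (marginal \<mu> B) \<tau>"
proof -
  let ?F = "{\<sigma>. restrict \<sigma> B = \<tau>}" and ?\<mu> = "cond_pmf \<mu> {\<sigma>. restrict \<sigma> B = \<tau>}"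
  have prob: "measure_pmf.prob \<mu> ?F = pmf (marginal \<mu> B) \<tau>"
    using prob_fiber[OF _ \<tau>, of \<mu>] pmf_marginal[OF _ \<tau>, of \<mu>] full by simp
  have ne: "set_pmf \<mu> \<inter> ?F \<noteq> {}"
    using marginal_pos[OF \<tau>] prob by (metis measure_pmf_zero_iff less_irrefl)
  have fib: "set_pmf \<mu> \<inter> ?F = (\<lambda>\<eta>. glue \<eta> \<tau>) ` configs s A"
    using fiber_eq[OF \<tau>] full by auto
  have law: "cond_law V \<mu> A \<tau> = map_pmf (\<lambda>\<sigma>. restrict \<sigma> A) ?\<mu>"
    by (simp add: cond_law_def B_def)
  show "set_pmf (cond_law V \<mu> A \<tau>) = configs s A"
    using \<tau> by (auto simp: law set_cond_pmf[OF ne] fib image_image)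
  assume \<eta>: "\<eta> \<in> configs s A"
  have "pmf (cond_law V \<mu> A \<tau>) (restrict (glue \<eta> \<tau>) A) = pmf ?\<mu> (glue \<eta> \<tau>)"
    unfolding law
  proof (rule pmf_map_inj)
    show "inj_on (\<lambda>\<sigma>. restrict \<sigma> A) (set_pmf ?\<mu>)"
      unfolding set_cond_pmf[OF ne] fib using \<tau> by (auto simp: inj_on_def)
    show "glue \<eta> \<tau> \<in> set_pmf ?\<mu>" unfolding set_cond_pmf[OF ne] fib using \<eta> by simp
  qed
  then show "pmf (cond_law V \<mu> A \<tau>) \<eta> = pmf \<mu> (glue \<eta> \<tau>) / pmf (marginal \<mu> B) \<tau>"
    using \<eta> \<tau> by (simp add: pmf_cond[OF ne] prob)
qed

text \<open>Given \<open>\<tau>\<close> outside the block, the density has conditional mean equal to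
  the ratio of the two marginals at \<open>\<tau>\<close>. Dividing by that mean inside the block
  entropy therefore splits off exactly the logarithm in the marginal divergence.\<close>

lemma kl_div_eq_marginal_plus_block_ent:
  assumes \<nu>: "set_pmf \<nu> \<subseteq> configs s V"
  shows "kl_div (configs s V) \<nu> \<mu> = kl_div (configs s B) (marginal \<nu> B) (marginal \<mu> B)
    + mean_block_ent V \<mu> A (\<lambda>\<sigma>. pmf \<nu> \<sigma> / pmf \<mu> \<sigma>)"
proof -
  let ?m = "\<lambda>\<eta> \<tau>. pmf \<mu> (glue \<eta> \<tau>)" and ?n = "\<lambda>\<eta> \<tau>. pmf \<nu> (glue \<eta> \<tau>)"
  let ?M = "pmf (marginal \<mu> B)" and ?N = "pmf (marginal \<nu> B)"
  let ?f = "\<lambda>\<sigma>. pmf \<nu> \<sigma> / pmf \<mu> \<sigma>"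
  \<comment> \<open>The factor \<open>?M \<tau>\<close> clears the denominator of the conditional
    law.\<close>
  have block: "?M \<tau> * block_ent V \<mu> A ?f \<tau>
      = (\<Sum>\<eta>\<in>configs s A. ?n \<eta> \<tau> * ln (?n \<eta> \<tau> / ?m \<eta> \<tau>)) - ?N \<tau> * ln (?N \<tau> / ?M \<tau>)"
    if \<tau>: "\<tau> \<in> configs s B" for \<tau>
  proof -
    have M: "?M \<tau> > 0" by (rule marginal_pos[OF \<tau>])
    have m: "?m \<eta> \<tau> > 0" if "\<eta> \<in> configs s A" for \<eta>
      using full that \<tau> by (intro pmf_positive) simp
    have ex: "measure_pmf.expectation (cond_law V \<mu> A \<tau>) g
        = (\<Sum>\<eta>\<in>configs s A. g \<eta> * (?m \<eta> \<tau> / ?M \<tau>))" for g :: "_ \<Rightarrow> real"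
      using set_cond_law[OF \<tau>]
      by (subst integral_measure_pmf_real[of "configs s A"]) (auto simp: pmf_cond_law[OF \<tau>])
    have mean: "measure_pmf.expectation (cond_law V \<mu> A \<tau>) (\<lambda>\<eta>. ?f (glue \<eta> \<tau>)) = ?N \<tau> / ?M \<tau>"
      unfolding ex pmf_marginal[OF \<nu> \<tau>] sum_divide_distrib
      using m by (intro sum.cong) (auto simp: less_imp_neq[symmetric])
    have "?M \<tau> * block_ent V \<mu> A ?f \<tau>
        = (\<Sum>\<eta>\<in>configs s A. ?n \<eta> \<tau> * ln ((?n \<eta> \<tau> / ?m \<eta> \<tau>) / (?N \<tau> / ?M \<tau>)))"
      unfolding block_ent_def ent_def B_def[symmetric] mean unfolding ex sum_distrib_left
      using m M by (intro sum.cong) (auto simp: less_imp_neq[symmetric])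
    also have "\<dots> = (\<Sum>\<eta>\<in>configs s A. ?n \<eta> \<tau> * ln (?n \<eta> \<tau> / ?m \<eta> \<tau>) - ?n \<eta> \<tau> * ln (?N \<tau> / ?M \<tau>))"
    proof (rule sum.cong)
      fix \<eta> assume \<eta>: "\<eta> \<in> configs s A"
      show "?n \<eta> \<tau> * ln ((?n \<eta> \<tau> / ?m \<eta> \<tau>) / (?N \<tau> / ?M \<tau>))
          = ?n \<eta> \<tau> * ln (?n \<eta> \<tau> / ?m \<eta> \<tau>) - ?n \<eta> \<tau> * ln (?N \<tau> / ?M \<tau>)"
      proof (cases "?n \<eta> \<tau> = 0")
        case False
        then have n: "?n \<eta> \<tau> > 0" by (simp add: pmf_neq_exists_less order.strict_iff_order)
        \<comment> \<open>A fiber carries at least the mass of each of its points; positivity of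
          \<open>?N \<tau>\<close> is what permits splitting the logarithm.\<close>
        also have "?n \<eta> \<tau> \<le> ?N \<tau>"
          unfolding pmf_marginal[OF \<nu> \<tau>] using \<eta> by (intro member_le_sum) auto
        finally have "?N \<tau> > 0" .
        then show ?thesis using n m[OF \<eta>] M
          by (simp add: ln_div right_diff_distrib del: divide_divide_eq_left divide_divide_eq_right)
      qed simp
    qed simp
    also have "\<dots> = (\<Sum>\<eta>\<in>configs s A. ?n \<eta> \<tau> * ln (?n \<eta> \<tau> / ?m \<eta> \<tau>)) - ?N \<tau> * ln (?N \<tau> / ?M \<tau>)"
      by (simp add: sum_subtractf pmf_marginal[OF \<nu> \<tau>] sum_distrib_right)
    finally show ?thesis .
  qed
  have "mean_block_ent V \<mu> A ?f = (\<Sum>\<tau>\<in>configs s B. ?M \<tau> * block_ent V \<mu> A ?f \<tau>)"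
    unfolding mean_block_ent_def B_def[symmetric] using full by (intro expectation_restrict) simp
  also have "\<dots> = kl_div (configs s V) \<nu> \<mu> - kl_div (configs s B) (marginal \<nu> B) (marginal \<mu> B)"
    by (simp add: block kl_div_def sum_subtractf sum_configs)
  finally show ?thesis by simp
qed

text \<open>Here \<open>r\<close> is the mass function of \<open>\<nu>\<close> after one update of
  \<open>A\<close>: the outside keeps its marginal and the block is redrawn from \<open>q\<close>.
  Both \<open>r\<close> and \<open>\<mu>\<close> factor as marginal times conditional law, so the
  logarithm of their ratio is a sum.\<close>

lemma sum_update_xlnx:
  assumes \<nu>: "set_pmf \<nu> \<subseteq> configs s V"
    and q: "\<And>\<tau>. \<tau> \<in> configs s B \<Longrightarrow> set_pmf (q \<tau>) \<subseteq> configs s A"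
  defines "r \<equiv> \<lambda>\<sigma>. pmf (marginal \<nu> B) (restrict \<sigma> B) * pmf (q (restrict \<sigma> B)) (restrict \<sigma> A)"
  shows "(\<Sum>\<sigma>\<in>configs s V. r \<sigma> * ln (r \<sigma> / pmf \<mu> \<sigma>))
    = kl_div (configs s B) (marginal \<nu> B) (marginal \<mu> B)
      + measure_pmf.expectation (marginal \<nu> B)
          (\<lambda>\<tau>. kl_div (configs s A) (q \<tau>) (cond_law V \<mu> A \<tau>))"
proof -
  let ?m = "\<lambda>\<eta> \<tau>. pmf \<mu> (glue \<eta> \<tau>)"
  let ?M = "pmf (marginal \<mu> B)" and ?N = "pmf (marginal \<nu> B)"
  have split: "(\<Sum>\<eta>\<in>configs s A. r (glue \<eta> \<tau>) * ln (r (glue \<eta> \<tau>) / ?m \<eta> \<tau>))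
      = ?N \<tau> * ln (?N \<tau> / ?M \<tau>) + ?N \<tau> * kl_div (configs s A) (q \<tau>) (cond_law V \<mu> A \<tau>)"
    if \<tau>: "\<tau> \<in> configs s B" for \<tau>
  proof -
    have M: "?M \<tau> > 0" by (rule marginal_pos[OF \<tau>])
    have "(\<Sum>\<eta>\<in>configs s A. r (glue \<eta> \<tau>) * ln (r (glue \<eta> \<tau>) / ?m \<eta> \<tau>))
        = (\<Sum>\<eta>\<in>configs s A. ?N \<tau> * ln (?N \<tau> / ?M \<tau>) * pmf (q \<tau>) \<eta>
            + ?N \<tau> * (pmf (q \<tau>) \<eta> * ln (pmf (q \<tau>) \<eta> / pmf (cond_law V \<mu> A \<tau>) \<eta>)))"
    proof (rule sum.cong)
      fix \<eta> assume \<eta>: "\<eta> \<in> configs s A"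
      have m: "?m \<eta> \<tau> > 0" using full \<eta> \<tau> by (intro pmf_positive) simp
      have r: "r (glue \<eta> \<tau>) = ?N \<tau> * pmf (q \<tau>) \<eta>" using \<eta> \<tau> by (simp add: r_def)
      show "r (glue \<eta> \<tau>) * ln (r (glue \<eta> \<tau>) / ?m \<eta> \<tau>) = ?N \<tau> * ln (?N \<tau> / ?M \<tau>) * pmf (q \<tau>) \<eta>
            + ?N \<tau> * (pmf (q \<tau>) \<eta> * ln (pmf (q \<tau>) \<eta> / pmf (cond_law V \<mu> A \<tau>) \<eta>))"
      proof (cases "?N \<tau> = 0 \<or> pmf (q \<tau>) \<eta> = 0")
        case False
        then have "?N \<tau> > 0" "pmf (q \<tau>) \<eta> > 0" by (auto simp: order.strict_iff_order)
        then show ?thesis unfolding r pmf_cond_law[OF \<tau> \<eta>] using m M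
          by (simp add: ln_div ln_mult algebra_simps)
      qed (auto simp: r)
    qed simp
    also have "\<dots> = ?N \<tau> * ln (?N \<tau> / ?M \<tau>) + ?N \<tau> * kl_div (configs s A) (q \<tau>) (cond_law V \<mu> A \<tau>)"
      using q[OF \<tau>]
      by (simp add: sum.distrib sum_pmf_eq_1 kl_div_def flip: sum_distrib_left)
    finally show ?thesis .
  qed
  have "measure_pmf.expectation (marginal \<nu> B) (\<lambda>\<tau>. kl_div (configs s A) (q \<tau>) (cond_law V \<mu> A \<tau>))
      = (\<Sum>\<tau>\<in>configs s B. ?N \<tau> * kl_div (configs s A) (q \<tau>) (cond_law V \<mu> A \<tau>))"
    using expectation_restrict[OF \<nu>] by (simp add: marginal_def)
  then show ?thesis
    by (simp add: sum_configs split sum.distrib kl_div_def)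
qed

end

text \<open>Serves the case of a negative constant, where the sign of the factorization bound
  matters.\<close>

lemma mean_block_ent_nonneg:
  assumes full: "set_pmf \<mu> = configs s V"
    and f: "\<And>\<sigma>. \<sigma> \<in> configs s V \<Longrightarrow> 0 \<le> f \<sigma>"
  shows "0 \<le> mean_block_ent V \<mu> A f"
proof -
  have "0 \<le> block_ent V \<mu> A f (restrict \<sigma> B)" if "\<sigma> \<in> configs s V" for \<sigma>
    unfolding block_ent_def B_def[symmetric]
    using that set_cond_law[OF full] f by (intro ent_nonneg) auto
  then show ?thesis
    unfolding mean_block_ent_def B_def[symmetric] using full
    by (intro integral_nonneg_AE) (auto simp: AE_measure_pmf_iff)
qed

text \<open>Two configurations on \<open>A\<close>, extended by the same outside, would give two on
  \<open>V\<close>.\<close>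

lemma configs_block_singleton:
  assumes "configs s V = {\<sigma>}"
  shows "configs s A = {restrict \<sigma> A}"
proof -
  have \<sigma>: "\<sigma> \<in> configs s V" using assms by simp
  have "\<eta> = restrict \<sigma> A" if "\<eta> \<in> configs s A" for \<eta>
    using glue_in[OF that restrict_in(2)[OF \<sigma>]] restrict_glue(1)[OF that restrict_in(2)[OF \<sigma>]]
    unfolding assms by simp
  then show ?thesis using restrict_in(1)[OF \<sigma>] by blast
qed

text \<open>The kernel fixes the outside, so only the fiber through \<open>\<sigma>\<close>
  contributes; on it the factor from \<open>q\<close> is constant, which leaves the fiber's
  mass.\<close>

lemma sum_block_kernel:
  assumes \<nu>: "set_pmf \<nu> \<subseteq> configs s V" and \<sigma>: "\<sigma> \<in> configs s V"
  shows "(\<Sum>\<tau>\<in>configs s V. pmf \<nu> \<tau> * block_kernel V q A \<tau> \<sigma>)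
    = pmf (marginal \<nu> B) (restrict \<sigma> B) * pmf (q A (restrict \<sigma> B)) (restrict \<sigma> A)"
proof -
  let ?F = "{\<tau> \<in> configs s V. restrict \<tau> B = restrict \<sigma> B}"
  have "(\<Sum>\<tau>\<in>configs s V. pmf \<nu> \<tau> * block_kernel V q A \<tau> \<sigma>)
      = (\<Sum>\<tau>\<in>?F. pmf \<nu> \<tau> * pmf (q A (restrict \<sigma> B)) (restrict \<sigma> A))"
    by (rule sum.mono_neutral_cong_right)
      (auto simp: block_kernel_def B_def[symmetric])
  also have "\<dots> = (\<Sum>\<tau>\<in>?F. pmf \<nu> \<tau>) * pmf (q A (restrict \<sigma> B)) (restrict \<sigma> A)"
    by (simp add: sum_distrib_right)
  also have "(\<Sum>\<tau>\<in>?F. pmf \<nu> \<tau>) = pmf (marginal \<nu> B) (restrict \<sigma> B)"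
    using \<sigma> by (simp add: fiber_eq sum.reindex[OF inj_glue] pmf_marginal[OF \<nu>])
  finally show ?thesis .
qed

end

section \<open>Divergence as entropy of a density, degenerate cases, and support of the Gibbs
  measure\<close>

text \<open>A density has mean 1, so the normalisation in \<open>ent\<close> disappears. This is how
  a statement about entropies becomes one about divergences.\<close>

lemma ent_density:
  assumes "finite X" "set_pmf \<nu> \<subseteq> X" "set_pmf \<mu> = X"
  shows "ent \<mu> (\<lambda>\<sigma>. pmf \<nu> \<sigma> / pmf \<mu> \<sigma>) = kl_div X \<nu> \<mu>"
proof -
  have pos: "pmf \<mu> \<sigma> > 0" if "\<sigma> \<in> X" for \<sigma> using assms that by (simp add: pmf_positive)
  have ex: "measure_pmf.expectation \<mu> g = (\<Sum>\<sigma>\<in>X. g \<sigma> * pmf \<mu> \<sigma>)" for g :: "_ \<Rightarrow> real"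
    using assms by (intro integral_measure_pmf_real) auto
  have "measure_pmf.expectation \<mu> (\<lambda>\<sigma>. pmf \<nu> \<sigma> / pmf \<mu> \<sigma>) = (\<Sum>\<sigma>\<in>X. pmf \<nu> \<sigma>)"
    unfolding ex using pos by (intro sum.cong) (auto simp: less_imp_neq[symmetric])
  then have "measure_pmf.expectation \<mu> (\<lambda>\<sigma>. pmf \<nu> \<sigma> / pmf \<mu> \<sigma>) = 1"
    using assms by (simp add: sum_pmf_eq_1)
  then show ?thesis
    unfolding ent_def kl_div_def using pos
    by (simp add: ex) (intro sum.cong, auto simp: less_imp_neq[symmetric])
qed

lemma kl_div_singleton: "set_pmf \<nu> \<subseteq> {x} \<Longrightarrow> set_pmf \<mu> \<subseteq> {x} \<Longrightarrow> kl_div {x} \<nu> \<mu> = 0"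
  by (simp add: kl_div_def set_pmf_subset_singleton)

text \<open>A test case for the factorization inequality: the value is positive unless
  \<open>x\<close> carries all the mass of \<open>\<mu>\<close>.\<close>

lemma kl_div_point_mass:
  assumes "finite X" "set_pmf \<mu> = X" "x \<in> X"
  shows "kl_div X (return_pmf x) \<mu> = - ln (pmf \<mu> x)"
proof -
  have "kl_div X (return_pmf x) \<mu> = (\<Sum>\<sigma>\<in>{x}. pmf (return_pmf x) \<sigma> * ln (pmf (return_pmf x) \<sigma> / pmf \<mu> \<sigma>))"
    unfolding kl_div_def using assms by (intro sum.mono_neutral_right) auto
  then show ?thesis using assms by (simp add: ln_div pmf_positive)
qed

lemma (in factor_graph) set_gibbs:
  assumes "configs s V \<noteq> {}"
  shows "set_pmf (gibbs s V I \<phi>) = configs s V"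
proof -
  have "(\<Sum>\<tau>\<in>configs s V. gibbs_weight I \<phi> \<tau>) > 0"
    using assms finite_configs[OF finite_V] by (intro sum_pos) (auto simp: gibbs_weight_def)
  then show ?thesis
    by (auto simp: set_pmf_eq pmf_gibbs[OF assms] gibbs_weight_def)
qed

theorem theorem3p2:
  fixes s :: nat
    and V :: "'v set"
    and I :: "'i set"
    and \<phi> :: "'i \<Rightarrow> ('v \<Rightarrow> nat) \<Rightarrow> real"
    and S :: "'i \<Rightarrow> 'v set"
    and E :: "'v set set"
    and \<mu> \<mu>' :: "('v \<Rightarrow> nat) pmf"
    and \<A> :: "'v set set"
    and p :: "'v set \<Rightarrow> real"
    and C :: real
    and q :: "'v set \<Rightarrow> ('v \<Rightarrow> nat) \<Rightarrow> ('v \<Rightarrow> nat) pmf"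
  assumes "factor_graph s V I \<phi> S E"
    and "\<mu> = gibbs s V I \<phi>"
    and "\<A> \<subseteq> Pow V"
    and "\<And>A. A \<in> \<A> \<Longrightarrow> 0 \<le> p A"
    and "(\<Sum>A\<in>\<A>. p A) = 1"
    and "min_cover V \<A> p > 0"
    and "\<And>f :: ('v \<Rightarrow> nat) \<Rightarrow> real. (\<And>\<sigma>. \<sigma> \<in> configs s V \<Longrightarrow> 0 \<le> f \<sigma>) \<Longrightarrow>
           min_cover V \<A> p * ent \<mu> f \<le> C * (\<Sum>A\<in>\<A>. p A * mean_block_ent V \<mu> A f)"
    and "\<And>A \<tau>. A \<in> \<A> \<Longrightarrow> \<tau> \<in> configs s (V - A) \<Longrightarrow> set_pmf (q A \<tau>) \<subseteq> configs s A"
    and "invariant_dist (configs s V) (scan_kernel V \<A> p q) \<mu>'"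
  shows "(hellinger_dist (configs s V) \<mu>' \<mu>)\<^sup>2 \<le> kl_div (configs s V) \<mu>' \<mu> \<and>
         kl_div (configs s V) \<mu>' \<mu> \<le>
           C / min_cover V \<A> p *
             (\<Sum>A\<in>\<A>. p A * measure_pmf.expectation (marginal \<mu>' (V - A))
                (\<lambda>\<tau>. kl_div (configs s A) (q A \<tau>) (cond_law V \<mu> A \<tau>)))"
proof -
  interpret factor_graph s V I \<phi> S E by fact
  let ?X = "configs s V" and ?\<gamma> = "min_cover V \<A> p"
  let ?f = "\<lambda>\<sigma>. pmf \<mu>' \<sigma> / pmf \<mu> \<sigma>"
  let ?Q = "\<lambda>A. measure_pmf.expectation (marginal \<mu>' (V - A))
                (\<lambda>\<tau>. kl_div (configs s A) (q A \<tau>) (cond_law V \<mu> A \<tau>))"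
  have finX: "finite ?X" by (rule finite_configs[OF finite_V])
  have fin\<A>: "finite \<A>" using assms(3) finite_V by (meson finite_Pow_iff finite_subset)
  have \<nu>: "set_pmf \<mu>' \<subseteq> ?X" using assms(9) by (simp add: invariant_dist_def)
  have inv: "(\<Sum>\<tau>\<in>?X. pmf \<mu>' \<tau> * scan_kernel V \<A> p q \<tau> \<sigma>) = pmf \<mu>' \<sigma>" if "\<sigma> \<in> ?X" for \<sigma>
    using assms(9) that by (simp add: invariant_dist_def)
  \<comment> \<open>The existence of \<open>\<mu>'\<close> excludes an empty configuration space, so
    the Gibbs formula applies.\<close>
  have "?X \<noteq> {}" using \<nu> set_pmf_not_empty[of \<mu>'] by auto
  then have full: "set_pmf \<mu> = ?X" using set_gibbs assms(2) by simp
  have pos: "pmf \<mu> \<sigma> > 0" if "\<sigma> \<in> ?X" for \<sigma> using full that by (intro pmf_positive) simp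
  have block: "config_block V A" if "A \<in> \<A>" for A
    using that assms(3) finite_V by unfold_locales auto
  \<comment> \<open>The mass function of \<open>\<mu>'\<close> after one update of the block
    \<open>A\<close>.\<close>
  define r where "r A \<sigma> = pmf (marginal \<mu>' (V - A)) (restrict \<sigma> (V - A))
      * pmf (q A (restrict \<sigma> (V - A))) (restrict \<sigma> A)" for A \<sigma>
  let ?D = "\<Sum>A\<in>\<A>. p A * mean_block_ent V \<mu> A ?f"
  let ?R = "\<Sum>A\<in>\<A>. p A * ?Q A"
  let ?M = "\<lambda>A. kl_div (configs s (V - A)) (marginal \<mu>' (V - A)) (marginal \<mu> (V - A))"

  have mixture: "pmf \<mu>' \<sigma> = (\<Sum>A\<in>\<A>. p A * r A \<sigma>)" if \<sigma>: "\<sigma> \<in> ?X" for \<sigma>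
  proof -
    have "pmf \<mu>' \<sigma> = (\<Sum>\<tau>\<in>?X. \<Sum>A\<in>\<A>. p A * (pmf \<mu>' \<tau> * block_kernel V q A \<tau> \<sigma>))"
      by (simp add: inv[OF \<sigma>, symmetric] scan_kernel_def sum_distrib_left mult.left_commute)
    also have "\<dots> = (\<Sum>A\<in>\<A>. \<Sum>\<tau>\<in>?X. p A * (pmf \<mu>' \<tau> * block_kernel V q A \<tau> \<sigma>))"
      by (rule sum.swap)
    also have "\<dots> = (\<Sum>A\<in>\<A>. p A * (\<Sum>\<tau>\<in>?X. pmf \<mu>' \<tau> * block_kernel V q A \<tau> \<sigma>))"
      by (simp add: sum_distrib_left)
    also have "\<dots> = (\<Sum>A\<in>\<A>. p A * r A \<sigma>)"
      unfolding r_def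
      by (intro sum.cong arg_cong2[where f = "(*)"] refl config_block.sum_block_kernel[OF block] \<nu> \<sigma>)
    finally show ?thesis .
  qed
  have "kl_div ?X \<mu>' \<mu> \<le> (\<Sum>\<sigma>\<in>?X. \<Sum>A\<in>\<A>. p A * (r A \<sigma> * ln (r A \<sigma> / pmf \<mu> \<sigma>)))"
    unfolding kl_div_def
  proof (rule sum_mono)
    fix \<sigma> assume \<sigma>: "\<sigma> \<in> ?X"
    show "pmf \<mu>' \<sigma> * ln (pmf \<mu>' \<sigma> / pmf \<mu> \<sigma>)
        \<le> (\<Sum>A\<in>\<A>. p A * (r A \<sigma> * ln (r A \<sigma> / pmf \<mu> \<sigma>)))"
      unfolding mixture[OF \<sigma>]
      by (intro mixture_xlnx_le fin\<A> assms(4,5) pos \<sigma>) (auto simp: r_def)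
  qed
  also have "\<dots> = (\<Sum>A\<in>\<A>. p A * (\<Sum>\<sigma>\<in>?X. r A \<sigma> * ln (r A \<sigma> / pmf \<mu> \<sigma>)))"
    by (subst sum.swap) (simp add: sum_distrib_left)
  also have "\<dots> = (\<Sum>A\<in>\<A>. p A * (?M A + ?Q A))"
  proof (rule sum.cong)
    fix A assume A: "A \<in> \<A>"
    show "p A * (\<Sum>\<sigma>\<in>?X. r A \<sigma> * ln (r A \<sigma> / pmf \<mu> \<sigma>)) = p A * (?M A + ?Q A)"
      unfolding r_def
      using config_block.sum_update_xlnx[OF block[OF A] full \<nu>, of "q A"] assms(8)[OF A] by simp
  qed simp
  finally have upper: "kl_div ?X \<mu>' \<mu> \<le> (\<Sum>A\<in>\<A>. p A * ?M A) + ?R"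
    by (simp add: distrib_left sum.distrib)
  \<comment> \<open>The weights sum to 1, so one copy of the divergence is available per block.
    Decomposing each copy produces the same sum of \<open>?M A\<close> as in \<open>upper\<close>,
    and it cancels.\<close>
  have "kl_div ?X \<mu>' \<mu> = (\<Sum>A\<in>\<A>. p A * kl_div ?X \<mu>' \<mu>)"
    using assms(5) by (simp flip: sum_distrib_right)
  also have "\<dots> = (\<Sum>A\<in>\<A>. p A * (?M A + mean_block_ent V \<mu> A ?f))"
    using config_block.kl_div_eq_marginal_plus_block_ent[OF block full \<nu>] by simp
  finally have DR: "?D \<le> ?R" using upper by (simp add: distrib_left sum.distrib)

  have main: "kl_div ?X \<mu>' \<mu> \<le> C / ?\<gamma> * ?R"
  \<comment> \<open>Multiplying \<open>DR\<close> by \<open>C\<close> preserves the inequality only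
    for nonnegative \<open>C\<close>, and the assumptions leave the sign open.\<close>
  proof (cases "0 \<le> C")
    case True
    have "?\<gamma> * kl_div ?X \<mu>' \<mu> \<le> C * ?D"
      using assms(7)[of ?f] by (simp add: ent_density[OF finX \<nu> full])
    also have "\<dots> \<le> C * ?R" using True DR by (intro mult_left_mono)
    finally show ?thesis using assms(6) by (simp add: field_simps)
  next
    case False
    \<comment> \<open>A negative constant forces every entropy to vanish, already that of the density of a point
      mass; hence the configuration space is a singleton and both sides are zero.\<close>
    obtain \<sigma> where \<sigma>: "\<sigma> \<in> ?X" using \<open>?X \<noteq> {}\<close> by auto
    let ?g = "\<lambda>x. pmf (return_pmf \<sigma>) x / pmf \<mu> x"
    have "?\<gamma> * (- ln (pmf \<mu> \<sigma>)) = ?\<gamma> * ent \<mu> ?g"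
      using \<sigma> ent_density[OF finX _ full, of "return_pmf \<sigma>"] kl_div_point_mass[OF finX full \<sigma>] by simp
    also have "\<dots> \<le> C * (\<Sum>A\<in>\<A>. p A * mean_block_ent V \<mu> A ?g)"
      by (rule assms(7)) simp
    also have "\<dots> \<le> 0"
      using False assms(4)
      by (intro mult_nonpos_nonneg sum_nonneg mult_nonneg_nonneg 
          config_block.mean_block_ent_nonneg[OF block full]) auto
    finally have "1 \<le> pmf \<mu> \<sigma>"
      using assms(6) pos[OF \<sigma>] by (simp add: mult_le_0_iff zero_le_mult_iff not_less)
    then have "pmf \<mu> \<sigma> = 1" using pmf_le_1[of \<mu> \<sigma>] by simp
    \<comment> \<open>Mass one at \<open>\<sigma>\<close> confines the support, which is all of
      \<open>?X\<close>, to this point.\<close>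
    then have "AE x in measure_pmf \<mu>. x \<in> {\<sigma>}"
      by (subst measure_pmf.AE_in_set_eq_1) (simp_all add: pmf.rep_eq)
    then have "?X \<subseteq> {\<sigma>}" unfolding AE_measure_pmf_iff full by blast
    then have single: "?X = {\<sigma>}" using \<sigma> by blast
    have "?Q A = 0" if A: "A \<in> \<A>" for A
    proof -
      interpret config_block s V A "V - A" by (rule block[OF A]) simp
      have "kl_div (configs s A) (q A \<tau>) (cond_law V \<mu> A \<tau>) = 0" if \<tau>: "\<tau> \<in> configs s (V - A)" for \<tau>
        using assms(8)[OF A \<tau>] set_cond_law[OF full \<tau>] configs_block_singleton[OF single]
        by (simp add: kl_div_singleton)
      then show ?thesis
        using set_marginal[OF \<nu>] by (intro integral_eq_zero_AE) (auto simp: AE_measure_pmf_iff)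
    qed
    then have "?R = 0" by simp
    moreover have "kl_div ?X \<mu>' \<mu> = 0" using single \<nu> full by (simp add: kl_div_singleton)
    ultimately show ?thesis by simp
  qed
  show ?thesis using hellinger_dist_le_kl_div[OF finX \<nu> full] main by simp
qed

end
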